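(* Let $1\le m<n$ be integers, let $T$ be a real $(n\times m)$-matrix of full rank $m$, and let $\mu>0$. Let $F:\mathbb{R}^n\to\mathbb{R}$ be a function with Fourier transform $\widehat{F}\in L_1(\mathbb{R}^n)$ and let $f:\mathbb{R}^m\to\mathbb{R}$, $f(x)=F(Tx)$, be its trace. Then the solution $$u(x)=\Big(\frac{1}{\sqrt{2\pi}}\Big)^m\int_{\mathbb{R}^m}\frac{1}{\mu+\|\omega\|^2}\,\widehat{f}(\omega)\,e^{i\omega\cdot x}\,d\omega$$ of the equation $-\Delta u+\mu u=f$ on $\mathbb{R}^m$ is the trace $u(x)=U(Tx)$, $x\in\mathbb{R}^m$, of the function $U:\mathbb{R}^n\to\mathbb{R}$ given by $$U(y)=\Big(\frac{1}{\sqrt{2\pi}}\Big)^n\int_{\mathbb{R}^n}\frac{1}{\mu+\|T^t\omega\|^2}\,\widehat{F}(\omega)\,e^{i\omega\cdot y}\,d\omega .$$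
   Context: A function $g:\mathbb{R}^d\to\mathbb{R}$ has Fourier transform $\widehat{g}\in L_1(\mathbb{R}^d)$ if $$g(x)=\Big(\frac{1}{\sqrt{2\pi}}\Big)^d\int_{\mathbb{R}^d}\widehat{g}(\omega)\,e^{i\omega\cdot x}\,d\omega\quad\text{for all }x\in\mathbb{R}^d;$$ such a $\widehat g$ is unique. The trace $f(x)=F(Tx)$ of a function $F$ with Fourier transform in $L_1(\mathbb{R}^n)$ has itself a Fourier transform $\widehat{f}$ in $L_1(\mathbb{R}^m)$. $\|\cdot\|$ is the euclidian norm on $\mathbb{R}^m$ and $T^t$ is the transpose of $T$. *)

theory Defs
  imports "HOL-Analysis.Analysis"
begin

definition inverse_fourier :: "(real ^ 'd \<Rightarrow> complex) \<Rightarrow> real ^ 'd \<Rightarrow> complex" where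
  "inverse_fourier h x =
     complex_of_real ((1 / sqrt (2 * pi)) ^ CARD('d)) *
     (\<integral>\<omega>. h \<omega> * exp (\<i> * complex_of_real (\<omega> \<bullet> x)) \<partial>lebesgue)"

text \<open>A relation rather than an operator, since the Fourier transform is unique only up to
  null sets.\<close>

definition has_L1_fourier_transform ::
    "(real ^ 'd \<Rightarrow> real) \<Rightarrow> (real ^ 'd \<Rightarrow> complex) \<Rightarrow> bool" where
  "has_L1_fourier_transform g h \<longleftrightarrow>
     integrable lebesgue h \<and> (\<forall>x. complex_of_real (g x) = inverse_fourier h x)"

definition partial_deriv :: "'d \<Rightarrow> (real ^ 'd \<Rightarrow> real) \<Rightarrow> real ^ 'd \<Rightarrow> real" where
  "partial_deriv i g x = frechet_derivative g (at x) (axis i 1)"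

definition C1_on_space :: "(real ^ 'd \<Rightarrow> real) \<Rightarrow> bool" where
  "C1_on_space g \<longleftrightarrow>
     (\<forall>x. g differentiable at x) \<and> (\<forall>i. continuous_on UNIV (partial_deriv i g))"

definition C2_on_space :: "(real ^ 'd \<Rightarrow> real) \<Rightarrow> bool" where
  "C2_on_space g \<longleftrightarrow> C1_on_space g \<and> (\<forall>i. C1_on_space (partial_deriv i g))"

definition laplacian :: "(real ^ 'd \<Rightarrow> real) \<Rightarrow> real ^ 'd \<Rightarrow> real" where
  "laplacian g x = (\<Sum>i\<in>UNIV. partial_deriv i (partial_deriv i g) x)"

text \<open>Solutions are classical: when the right-hand side has an integrable Fourier transform,
  the solution given by the Fourier integral is twice continuously differentiable.\<close>

definition solves_screened_poisson ::
    "real \<Rightarrow> (real ^ 'd \<Rightarrow> real) \<Rightarrow> (real ^ 'd \<Rightarrow> real) \<Rightarrow> bool" where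
  "solves_screened_poisson \<mu> f u \<longleftrightarrow>
     C2_on_space u \<and> (\<forall>x. - laplacian u x + \<mu> * u x = f x)"

end

theory Submission
  imports Defs "HOL-Probability.Characteristic_Functions"
begin

text \<open>
  A Gaussian vector observed at an independent exponential time has the characteristic function
  \<open>\<mu> / (\<mu> + |\<omega>|\<^sup>2)\<close>. By Fubini, both resolvents are therefore averages over the law \<open>P\<close> of this vector:
  \<open>\<mu> u(x)\<close> is the integral of \<open>f(x + z)\<close> and \<open>\<mu> U(y)\<close> that of \<open>F(y + Tz)\<close> with respect to \<open>P(dz)\<close>.
  This shows at once that \<open>u\<close> and \<open>U\<close> are real and that \<open>u(x) = U(Tx)\<close>, without the uniqueness
  theorem for Fourier transforms. The Fourier transform of \<open>f\<close> is, up to a constant, the density of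
  the image of the complex measure \<open>F_hat(\<omega>) d\<omega>\<close> under the surjection \<open>T\<^sup>t\<close>; it exists by
  Radon-Nikodym, and the differential equation follows by differentiation under the integral.
\<close>

section \<open>Images of absolutely continuous measures under linear surjections\<close>

text \<open>Fubini is applied later to a product with \<open>lebesgue\<close>. Completing
  \<open>lborel\<close> does not change the measure of Borel sets, so a countable Borel cover by
  sets of finite measure still serves.\<close>

lemma sigma_finite_lebesgue: "sigma_finite_measure (lebesgue :: 'a::euclidean_space measure)"
proof -
  obtain A :: "'a set set" where "countable A" "A \<subseteq> sets lborel" "\<Union>A = space lborel"
    "\<forall>a\<in>A. emeasure lborel a \<noteq> \<infinity>"
    using lborel.sigma_finite_countable by blast
  then show ?thesis
    by (intro sigma_finite_measure.intro exI[of _ A]) (auto simp: subset_eq)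
qed

lemma borel_measurable_linear:
  fixes L :: "'a::euclidean_space \<Rightarrow> 'b::euclidean_space"
  shows "linear L \<Longrightarrow> L \<in> borel_measurable borel"
  by (simp add: borel_measurable_continuous_onI linear_continuous_on linear_linear)

text \<open>Integrating over all translates \<open>R z\<close> by a right inverse \<open>R\<close> of \<open>L\<close> and exchanging the integrals
  reduces the claim to translates of \<open>N\<close> itself, so no coordinates adapted to the kernel of \<open>L\<close> are needed.\<close>

lemma emeasure_lborel_vimage_linear_eq_0:
  fixes L :: "'a::euclidean_space \<Rightarrow> 'b::euclidean_space"
  assumes "linear L" "surj L" and N: "N \<in> null_sets lborel"
  shows "emeasure lborel (L -` N) = 0"
proof -
  obtain R where R: "linear R" "L \<circ> R = id"
    using linear_surjective_right_inverse[OF assms(1,2)] by blast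
  have LR: "L (R z) = z" for z
    using R(2) by (metis comp_apply id_apply)
  have [measurable]: "L \<in> borel_measurable borel" "R \<in> borel_measurable borel"
    using assms(1) R(1) by (auto intro: borel_measurable_linear)
  have [measurable]: "N \<in> sets borel"
    using N by auto
  have [measurable]: "L -` N \<in> sets borel"
    using measurable_sets[of L borel borel N] by simp
  \<comment> \<open>For fixed \<open>z\<close> the shift by \<open>R z\<close> takes place in the
    domain, and translation invariance removes it.\<close>
  have shift_dom: "(\<integral>\<^sup>+\<omega>. indicator N (L (R z + \<omega>)) \<partial>lborel) = emeasure lborel (L -` N)" for z
  proof -
    have "(\<integral>\<^sup>+\<omega>. indicator N (L (R z + \<omega>)) \<partial>lborel) = (\<integral>\<^sup>+\<omega>. indicator N (L \<omega>) \<partial>distr lborel borel ((+) (R z)))"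
      by (subst nn_integral_distr) auto
    also have "\<dots> = (\<integral>\<^sup>+\<omega>. indicator (L -` N) \<omega> \<partial>lborel)"
      by (simp add: lborel_distr_plus indicator_def)
    also have "\<dots> = emeasure lborel (L -` N)"
      by simp
    finally show ?thesis .
  qed
  \<comment> \<open>For fixed \<omega>, \<open>L (R z) = z\<close> turns the same expression into
    the measure of a translate of the null set \<open>N\<close>.\<close>
  have shift_ran: "(\<integral>\<^sup>+z. indicator N (L (R z + \<omega>)) \<partial>lborel) = 0" for \<omega>
  proof -
    have "(\<integral>\<^sup>+z. indicator N (L (R z + \<omega>)) \<partial>lborel) = (\<integral>\<^sup>+z. indicator N (L \<omega> + z) \<partial>lborel)"
      using assms(1) by (simp add: linear_add LR add.commute)
    also have "\<dots> = (\<integral>\<^sup>+z. indicator N z \<partial>distr lborel borel ((+) (L \<omega>)))"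
      by (subst nn_integral_distr) auto
    also have "\<dots> = 0"
      using N by (simp add: lborel_distr_plus null_setsD1)
    finally show ?thesis .
  qed
  \<comment> \<open>The codomain has infinite total mass, so a vanishing double integral means c *
    \<infinity> = 0 for c the measure in question, which forces c = 0.\<close>
  have "emeasure lborel (L -` N) * \<infinity> = (\<integral>\<^sup>+z. emeasure lborel (L -` N) \<partial>(lborel :: 'b measure))"
    by simp
  also have "\<dots> = (\<integral>\<^sup>+(z::'b). \<integral>\<^sup>+\<omega>. indicator N (L (R z + \<omega>)) \<partial>lborel \<partial>lborel)"
    by (simp add: shift_dom)
  also have "\<dots> = (\<integral>\<^sup>+\<omega>. \<integral>\<^sup>+(z::'b). indicator N (L (R z + \<omega>)) \<partial>lborel \<partial>lborel)"
    by (rule lborel_pair.Fubini') measurable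
  also have "\<dots> = 0"
    by (simp add: shift_ran)
  finally show ?thesis
    by (auto simp: ennreal_mult_eq_top_iff ennreal_mult_top split: if_splits)
qed

text \<open>The measure with density \<open>h\<close> has a finite image under \<open>L\<close>,
  absolutely continuous because preimages of null sets are null; \<open>k\<close> is its
  Radon-Nikodym derivative. The identity covers every Borel \<phi>: if the integrands are not
  integrable, both integrals have the default value 0.\<close>

lemma pushforward_density_nonneg:
  fixes L :: "'a::euclidean_space \<Rightarrow> 'b::euclidean_space" and h :: "'a \<Rightarrow> real"
  assumes L: "linear L" "surj L" and h: "integrable lebesgue h" "\<And>x. h x \<ge> 0"
  obtains k :: "'b \<Rightarrow> real" where "integrable lborel k"
    "\<And>\<phi> :: 'b \<Rightarrow> complex. \<phi> \<in> borel_measurable borel \<Longrightarrow>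
      (\<integral>\<omega>. h \<omega> *\<^sub>R \<phi> (L \<omega>) \<partial>lebesgue) = (\<integral>\<xi>. k \<xi> *\<^sub>R \<phi> \<xi> \<partial>lborel)"
proof -
  have L_borel: "L \<in> borel_measurable borel"
    using L(1) by (rule borel_measurable_linear)
  have L_leb[measurable]: "L \<in> lebesgue \<rightarrow>\<^sub>M borel"
    using L_borel by (simp add: measurable_completion)
  have hm[measurable]: "h \<in> borel_measurable lebesgue"
    using h by auto
  define N where "N = distr (density lebesgue h) borel L"
  have sets_N[simp]: "sets N = sets lborel" "space N = UNIV"
    by (simp_all add: N_def)
  have N_UNIV: "emeasure N UNIV = ennreal (\<integral>x. h x \<partial>lebesgue)"
    unfolding N_def using h
    by (simp add: emeasure_distr emeasure_density nn_integral_eq_integral)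
  have fin: "finite_measure N"
    by (rule finite_measureI) (simp add: N_UNIV)
  have ac: "absolutely_continuous lborel N"
    unfolding absolutely_continuous_def
  proof
    fix A :: "'b set" assume A: "A \<in> null_sets lborel"
    then have [measurable]: "A \<in> sets borel" by auto
    have "L -` A \<in> sets borel"
      using measurable_sets[OF L_borel, of A] by simp
    then have "L -` A \<in> null_sets lebesgue"
      using emeasure_lborel_vimage_linear_eq_0[OF L A] by (auto)
    then have "AE x in lebesgue. x \<notin> L -` A"
      by (rule AE_not_in)
    then have "(\<integral>\<^sup>+x. ennreal (h x) * indicator (L -` A) x \<partial>lebesgue) = (\<integral>\<^sup>+(x::'a). 0 \<partial>lebesgue)"
      by (intro nn_integral_cong_AE) (auto elim!: eventually_mono)
    then have "emeasure N A = 0"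
      unfolding N_def using \<open>L -` A \<in> null_sets lebesgue\<close>
      by (simp add: emeasure_distr emeasure_density null_setsD2)
    then show "A \<in> null_sets N"
      using A by (auto simp: null_sets_def)
  qed
  \<comment> \<open>Since \<open>N\<close> is finite, its density is finite almost everywhere and
    has a real-valued version.\<close>
  obtain k where k[measurable]: "k \<in> borel_measurable lborel"
    and k_AE: "AE x in lborel. RN_deriv lborel N x = ennreal (k x)" and k0: "\<And>x. 0 \<le> k x"
    using sigma_finite_measure.real_RN_deriv[OF sigma_finite_lborel fin ac] by auto
  have N_eq: "N = density lborel k"
  proof -
    have "N = density lborel (RN_deriv lborel N)"
      using sigma_finite_measure.density_RN_deriv[OF sigma_finite_lborel ac] by simp
    also have "\<dots> = density lborel k"
      using k_AE by (intro density_cong) auto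
    finally show ?thesis .
  qed
  have "(\<integral>\<^sup>+x. ennreal (k x) \<partial>lborel) = emeasure N UNIV"
    by (simp add: N_eq emeasure_density)
  then have "integrable lborel k"
    using k0 by (intro integrableI_nonneg) (auto simp: N_UNIV)
  moreover have "(\<integral>\<omega>. h \<omega> *\<^sub>R \<phi> (L \<omega>) \<partial>lebesgue) = (\<integral>\<xi>. k \<xi> *\<^sub>R \<phi> \<xi> \<partial>lborel)"
    if [measurable]: "\<phi> \<in> borel_measurable borel" for \<phi> :: "'b \<Rightarrow> complex"
  proof -
    have "(\<integral>\<omega>. h \<omega> *\<^sub>R \<phi> (L \<omega>) \<partial>lebesgue) = (\<integral>\<omega>. \<phi> (L \<omega>) \<partial>density lebesgue h)"
      by (subst integral_density) (auto simp: h)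
    also have "\<dots> = (\<integral>\<xi>. \<phi> \<xi> \<partial>N)"
      unfolding N_def by (subst integral_distr) auto
    also have "\<dots> = (\<integral>\<xi>. k \<xi> *\<^sub>R \<phi> \<xi> \<partial>lborel)"
      unfolding N_eq by (subst integral_density) (auto simp: k0)
    finally show ?thesis .
  qed
  ultimately show ?thesis
    by (rule that)
qed

text \<open>A complex weight splits into four nonnegative parts, whose image densities are
  recombined with the same coefficients. Boundedness of \<phi> makes each part integrable against
  it, so that the integral may be split.\<close>

lemma pushforward_density:
  fixes L :: "'a::euclidean_space \<Rightarrow> 'b::euclidean_space" and H :: "'a \<Rightarrow> complex"
  assumes L: "linear L" "surj L" and H: "integrable lebesgue H"
  obtains K :: "'b \<Rightarrow> complex" where "integrable lebesgue K"
    "\<And>\<phi>. \<phi> \<in> borel_measurable borel \<Longrightarrow> bounded (range \<phi>) \<Longrightarrow>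
      (\<integral>\<omega>. H \<omega> * \<phi> (L \<omega>) \<partial>lebesgue) = (\<integral>\<xi>. K \<xi> * \<phi> \<xi> \<partial>lebesgue)"
proof -
  \<comment> \<open>for \<open>c\<close> ranging over the fourth roots of unity: the positive and negative parts of \<open>Re H\<close> and \<open>Im H\<close>\<close>
  define part where "part = (\<lambda>c \<omega>. max 0 (Re (cnj c * H \<omega>)))"
  have part_int: "integrable lebesgue (part c)" for c
    unfolding part_def using H by (intro integrable_max) auto
  have "\<exists>k. \<forall>c. integrable lborel (k c) \<and> (\<forall>\<phi> :: 'b \<Rightarrow> complex. \<phi> \<in> borel_measurable borel \<longrightarrow>
      (\<integral>\<omega>. part c \<omega> *\<^sub>R \<phi> (L \<omega>) \<partial>lebesgue) = (\<integral>\<xi>. k c \<xi> *\<^sub>R \<phi> \<xi> \<partial>lborel))"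
  proof (intro choice allI)
    fix c
    have "part c \<omega> \<ge> 0" for \<omega>
      by (simp add: part_def)
    then show "\<exists>k. integrable lborel k \<and> (\<forall>\<phi> :: 'b \<Rightarrow> complex. \<phi> \<in> borel_measurable borel \<longrightarrow>
      (\<integral>\<omega>. part c \<omega> *\<^sub>R \<phi> (L \<omega>) \<partial>lebesgue) = (\<integral>\<xi>. k \<xi> *\<^sub>R \<phi> \<xi> \<partial>lborel))"
      using pushforward_density_nonneg[OF L part_int[of c]] by blast
  qed
  then obtain k where k_all: "\<forall>c. integrable lborel (k c) \<and> (\<forall>\<phi> :: 'b \<Rightarrow> complex. \<phi> \<in> borel_measurable borel \<longrightarrow>
      (\<integral>\<omega>. part c \<omega> *\<^sub>R \<phi> (L \<omega>) \<partial>lebesgue) = (\<integral>\<xi>. k c \<xi> *\<^sub>R \<phi> \<xi> \<partial>lborel))" ..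
  have k_int: "integrable lborel (k c)" for c
    using k_all by simp
  have k: "(\<integral>\<omega>. part c \<omega> *\<^sub>R \<phi> (L \<omega>) \<partial>lebesgue) = (\<integral>\<xi>. k c \<xi> *\<^sub>R \<phi> \<xi> \<partial>lborel)"
    if "\<phi> \<in> borel_measurable borel" for c and \<phi> :: "'b \<Rightarrow> complex"
    using k_all that by simp
  let ?C = "{1, -1, \<i>, -\<i>}"
  define K where "K = (\<lambda>\<xi>. \<Sum>c\<in>?C. c * complex_of_real (k c \<xi>))"
  \<comment> \<open>For c = 1, -1, \<i>, -\<i> the number \<open>Re (cnj c * H \<omega>)\<close> is
    Re H, -Re H, Im H, -Im H, and a real number is its positive part minus its negative
    part.\<close>
  have H_eq: "H \<omega> = (\<Sum>c\<in>?C. c * complex_of_real (part c \<omega>))" for \<omega>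
    by (auto simp: part_def complex_eq_iff)
  have k_leb: "integrable lebesgue (k c)" for c
    using k_int by (simp add: integrable_completion borel_measurable_integrable)
  have K_int: "integrable lebesgue K"
    unfolding K_def using k_leb by (intro Bochner_Integration.integrable_sum integrable_mult_right integrable_of_real)
  moreover have "(\<integral>\<omega>. H \<omega> * \<phi> (L \<omega>) \<partial>lebesgue) = (\<integral>\<xi>. K \<xi> * \<phi> \<xi> \<partial>lebesgue)"
    if \<phi>[measurable]: "\<phi> \<in> borel_measurable borel" and "bounded (range \<phi>)" for \<phi> :: "'b \<Rightarrow> complex"
  proof -
    obtain B where B: "\<And>x. norm (\<phi> x) \<le> B"
      using \<open>bounded (range \<phi>)\<close> by (auto simp: bounded_iff)
    have L_leb[measurable]: "L \<in> lebesgue \<rightarrow>\<^sub>M borel"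
      using borel_measurable_linear[OF L(1)] by (simp add: measurable_completion)
    have \<phi>_leb[measurable]: "\<phi> \<in> borel_measurable lebesgue"
      by (simp add: measurable_completion)
    have B_abs: "norm (\<phi> x) \<le> \<bar>B\<bar>" for x
      using B[of x] by simp
    have int1: "integrable lebesgue (\<lambda>\<omega>. c * (part c \<omega> *\<^sub>R \<phi> (L \<omega>)))" for c
    proof (intro integrable_mult_right, rule Bochner_Integration.integrable_bound)
      show "integrable lebesgue (\<lambda>\<omega>. B * part c \<omega>)"
        using part_int by auto
      show "(\<lambda>\<omega>. part c \<omega> *\<^sub>R \<phi> (L \<omega>)) \<in> borel_measurable lebesgue"
        using borel_measurable_integrable[OF part_int[of c]] by measurable
      show "AE x in lebesgue. norm (part c x *\<^sub>R \<phi> (L x)) \<le> norm (B * part c x)"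
        using B_abs by (intro AE_I2) (simp add: abs_mult mult.commute[of "\<bar>B\<bar>"] mult_left_mono)
    qed
    have int2: "integrable lebesgue (\<lambda>\<omega>. c * (k c \<omega> *\<^sub>R \<phi> \<omega>))" for c
    proof (intro integrable_mult_right, rule Bochner_Integration.integrable_bound)
      show "integrable lebesgue (\<lambda>\<omega>. B * k c \<omega>)"
        using k_leb by auto
      show "(\<lambda>\<omega>. k c \<omega> *\<^sub>R \<phi> \<omega>) \<in> borel_measurable lebesgue"
        using borel_measurable_integrable[OF k_leb[of c]] by measurable
      show "AE x in lebesgue. norm (k c x *\<^sub>R \<phi> x) \<le> norm (B * k c x)"
        using B_abs by (intro AE_I2) (simp add: abs_mult mult.commute[of "\<bar>B\<bar>"] mult_left_mono)
    qed
    have "(\<integral>\<omega>. H \<omega> * \<phi> (L \<omega>) \<partial>lebesgue) = (\<integral>\<omega>. (\<Sum>c\<in>?C. c * (part c \<omega> *\<^sub>R \<phi> (L \<omega>))) \<partial>lebesgue)"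
      by (subst H_eq) (simp add: sum_distrib_right scaleR_conv_of_real mult.assoc del: sum.insert)
    also have "\<dots> = (\<Sum>c\<in>?C. \<integral>\<omega>. c * (part c \<omega> *\<^sub>R \<phi> (L \<omega>)) \<partial>lebesgue)"
      by (rule Bochner_Integration.integral_sum) (rule int1)
    also have "\<dots> = (\<Sum>c\<in>?C. c * (\<integral>\<xi>. k c \<xi> *\<^sub>R \<phi> \<xi> \<partial>lborel))"
      by (simp add: k[OF \<phi>] del: sum.insert mult_scaleR_right)
    \<comment> \<open>The integrands are Borel functions, for which \<open>lborel\<close> and its
      completion give the same integral.\<close>
    also have "\<dots> = (\<Sum>c\<in>?C. \<integral>\<xi>. c * (k c \<xi> *\<^sub>R \<phi> \<xi>) \<partial>lebesgue)"
    proof (intro sum.cong refl)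
      fix c
      have "(\<lambda>\<omega>. k c \<omega> *\<^sub>R \<phi> \<omega>) \<in> borel_measurable lborel"
        using borel_measurable_integrable[OF k_int[of c]] by measurable
      then show "c * (\<integral>\<xi>. k c \<xi> *\<^sub>R \<phi> \<xi> \<partial>lborel) = (\<integral>\<xi>. c * (k c \<xi> *\<^sub>R \<phi> \<xi>) \<partial>lebesgue)"
        by (simp add: integral_completion del: mult_scaleR_right)
    qed
    also have "\<dots> = (\<integral>\<xi>. (\<Sum>c\<in>?C. c * (k c \<xi> *\<^sub>R \<phi> \<xi>)) \<partial>lebesgue)"
      by (rule Bochner_Integration.integral_sum[symmetric]) (rule int2)
    also have "\<dots> = (\<integral>\<xi>. K \<xi> * \<phi> \<xi> \<partial>lebesgue)"
      by (simp add: K_def sum_distrib_right scaleR_conv_of_real mult.assoc del: sum.insert)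
    finally show ?thesis .
  qed
  ultimately show ?thesis
    by (rule that)
qed

section \<open>The probability measure with the resolvent as characteristic function\<close>

text \<open>This is the Laplace transform of the exponential law: the factor exp (-s t) turns the
  density of rate \<mu> into \<mu> / (\<mu> + s) times the density of rate \<mu> + s, which has mass
  1.\<close>

lemma integral_exponential_density_exp:
  assumes "\<mu> > 0" "s \<ge> (0::real)"
  shows "(\<integral>t. exp (- s * t) \<partial>density lborel (exponential_density \<mu>)) = \<mu> / (\<mu> + s)"
proof -
  interpret prob_space "density lborel (exponential_density (\<mu> + s))"
    using assms by (intro prob_space_exponential_density) auto
  have nn: "exponential_density (\<mu> + s) t \<ge> 0" "exponential_density \<mu> t \<ge> 0" for t
    using assms exponential_density_nonneg by auto
  have "(\<integral>t. exp (- s * t) \<partial>density lborel (exponential_density \<mu>)) =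
      (\<integral>t. exponential_density \<mu> t * exp (- s * t) \<partial>lborel)"
    by (subst integral_density) (auto simp: nn)
  also have "\<dots> = (\<integral>t. (\<mu> / (\<mu> + s)) * exponential_density (\<mu> + s) t \<partial>lborel)"
    using assms
    by (intro Bochner_Integration.integral_cong)
       (auto simp: exponential_density_def field_simps simp flip: exp_add)
  also have "\<dots> = (\<mu> / (\<mu> + s)) * (\<integral>t. 1 \<partial>density lborel (exponential_density (\<mu> + s)))"
    by (subst integral_density) (auto simp: nn)
  also have "\<dots> = \<mu> / (\<mu> + s)"
    using prob_space by simp
  finally show ?thesis .
qed

text \<open>Independent standard normal coordinates give the vector: the exponential of the inner
  product is a product over the coordinates, so the characteristic function factors.\<close>

lemma standard_normal_vector_exists:
  "\<exists>P :: (real ^ 'd) measure. prob_space P \<and> sets P = sets borel \<and>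
    (\<forall>\<omega>. (\<integral>x. exp (\<i> * complex_of_real (\<omega> \<bullet> x)) \<partial>P) = complex_of_real (exp (- (norm \<omega>)\<^sup>2 / 2)))"
proof (intro exI conjI allI)
  interpret std: real_distribution std_normal_distribution
    by (rule real_dist_normal_dist)
  interpret product_prob_space "\<lambda>_::'d. std_normal_distribution" UNIV
    by unfold_locales
  let ?M = "Pi\<^sub>M (UNIV :: 'd set) (\<lambda>_. std_normal_distribution)"
  let ?P = "distr ?M borel vec_lambda"
  have X[measurable]: "vec_lambda \<in> ?M \<rightarrow>\<^sub>M (borel :: (real ^ 'd) measure)"
  proof (subst borel_measurable_euclidean_space, intro ballI)
    fix b :: "real ^ 'd" assume "b \<in> Basis"
    then obtain i where b: "b = axis i 1"
      by (auto simp: Basis_vec_def)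
    have "(\<lambda>x. x i) \<in> ?M \<rightarrow>\<^sub>M (borel :: real measure)"
      using measurable_component_singleton[of i UNIV "\<lambda>_. std_normal_distribution"] by simp
    then show "(\<lambda>x. vec_lambda x \<bullet> b) \<in> borel_measurable ?M"
      by (simp add: b inner_axis)
  qed
  show "prob_space ?P"
    by (rule prob_space_distr) simp
  show "sets ?P = sets borel"
    by simp
  fix \<omega> :: "real ^ 'd"
  have "(\<integral>x. exp (\<i> * complex_of_real (\<omega> \<bullet> x)) \<partial>?P) = (\<integral>x. exp (\<i> * complex_of_real (\<omega> \<bullet> vec_lambda x)) \<partial>?M)"
    by (subst integral_distr) auto
  also have "\<dots> = (\<integral>x. (\<Prod>i\<in>UNIV. iexp (\<omega> $ i * x i)) \<partial>?M)"
    by (simp add: inner_vec_def exp_sum sum_distrib_left)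
  also have "\<dots> = (\<Prod>i\<in>UNIV. char std_normal_distribution (\<omega> $ i))"
    unfolding char_def by (rule product_integral_prod) (auto intro!: std.integrable_iexp)
  also have "\<dots> = complex_of_real (exp (\<Sum>i\<in>UNIV. - (\<omega> $ i)\<^sup>2 / 2))"
    by (simp add: char_std_normal_distribution exp_sum)
  also have "(\<Sum>i\<in>UNIV. - (\<omega> $ i)\<^sup>2 / 2) = - (norm \<omega>)\<^sup>2 / 2"
    by (simp add: norm_vec_def L2_set_def sum_nonneg sum_negf sum_divide_distrib)
  finally show "(\<integral>x. exp (\<i> * complex_of_real (\<omega> \<bullet> x)) \<partial>?P) = complex_of_real (exp (- (norm \<omega>)\<^sup>2 / 2))" .
qed

text \<open>The resolvent is the Laplace transform of the heat semigroup: \<mu> / (\<mu> +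
  |\<omega>|^2) is the mean of exp (-t |\<omega>|^2) over an exponential time t of rate
  \<mu>.\<close>

lemma resolvent_measure_exists:
  assumes "\<mu> > 0"
  shows "\<exists>P :: (real ^ 'd) measure. prob_space P \<and> sets P = sets borel \<and>
    (\<forall>\<omega>. (\<integral>x. exp (\<i> * complex_of_real (\<omega> \<bullet> x)) \<partial>P) = complex_of_real (\<mu> / (\<mu> + (norm \<omega>)\<^sup>2)))"
proof -
  obtain G :: "(real ^ 'd) measure" where "prob_space G" and sets_G[measurable_cong]: "sets G = sets borel"
    and G: "\<And>\<omega>. (\<integral>x. exp (\<i> * complex_of_real (\<omega> \<bullet> x)) \<partial>G) = complex_of_real (exp (- (norm \<omega>)\<^sup>2 / 2))"
    using standard_normal_vector_exists by blast
  define E where "E = density lborel (exponential_density \<mu>)"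
  have sets_E[measurable_cong]: "sets E = sets borel"
    by (simp add: E_def)
  interpret G: prob_space G by fact
  interpret E: prob_space E
    unfolding E_def using assms by (rule prob_space_exponential_density)
  interpret pair_prob_space E G ..
  \<comment> \<open>The variance 2t per coordinate turns the Gaussian exponent -|\<omega>|^2 / 2
    into -t |\<omega>|^2.\<close>
  define Y where "Y = (\<lambda>(t, x). sqrt (2 * t) *\<^sub>R x :: real ^ 'd)"
  have Y[measurable]: "Y \<in> E \<Otimes>\<^sub>M G \<rightarrow>\<^sub>M borel"
    unfolding Y_def by measurable
  have "(\<integral>x. exp (\<i> * complex_of_real (\<omega> \<bullet> x)) \<partial>distr (E \<Otimes>\<^sub>M G) borel Y) =
      complex_of_real (\<mu> / (\<mu> + (norm \<omega>)\<^sup>2))" for \<omega>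
  proof -
    \<comment> \<open>The factor sqrt (2t) is moved from x to \<omega>, so that the inner integral
      is the characteristic function of \<open>G\<close> at
      \<open>sqrt (2 * t) *\<^sub>R \<omega>\<close>.\<close>
    let ?e = "\<lambda>(t, x). exp (\<i> * complex_of_real ((sqrt (2 * t) *\<^sub>R \<omega>) \<bullet> x))"
    have "(\<integral>x. exp (\<i> * complex_of_real (\<omega> \<bullet> x)) \<partial>distr (E \<Otimes>\<^sub>M G) borel Y) = (\<integral>p. ?e p \<partial>(E \<Otimes>\<^sub>M G))"
      by (subst integral_distr) (auto simp: Y_def case_prod_unfold)
    also have "\<dots> = (\<integral>t. \<integral>x. ?e (t, x) \<partial>G \<partial>E)"
    proof (rule integral_fst'[symmetric], rule P.integrable_const_bound[where B = 1])
      show "?e \<in> borel_measurable (E \<Otimes>\<^sub>M G)"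
        by measurable
    qed auto
    also have "\<dots> = (\<integral>t. complex_of_real (exp (- (norm \<omega>)\<^sup>2 * t)) \<partial>E)"
    proof (rule integral_cong_AE)
      \<comment> \<open>The square of \<open>sqrt (2 * t)\<close> is 2t only for t \<ge> 0; negative
        times carry no mass.\<close>
      have "AE t in E. t \<ge> 0"
        unfolding E_def by (subst AE_density) (auto simp: exponential_density_def)
      then show "AE t in E. (\<integral>x. ?e (t, x) \<partial>G) = complex_of_real (exp (- (norm \<omega>)\<^sup>2 * t))"
        proof eventually_elim
        fix t :: real assume "t \<ge> 0"
        then show "(\<integral>x. ?e (t, x) \<partial>G) = complex_of_real (exp (- (norm \<omega>)\<^sup>2 * t))"
          using G[of "sqrt (2 * t) *\<^sub>R \<omega>"] by (simp add: power_mult_distrib)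
      qed
    qed (measurable)
    also have "\<dots> = complex_of_real (\<mu> / (\<mu> + (norm \<omega>)\<^sup>2))"
      using integral_exponential_density_exp[OF assms, of "(norm \<omega>)\<^sup>2"]
      by (simp only: E_def integral_complex_of_real) simp
    finally show ?thesis .
  qed
  moreover have "prob_space (distr (E \<Otimes>\<^sub>M G) borel Y)"
    by (rule prob_space_distr) simp
  ultimately show ?thesis
    by (intro exI[of _ "distr (E \<Otimes>\<^sub>M G) borel Y"]) simp
qed

section \<open>Fourier integrals and traces\<close>

lemma measurable_lebesgue_ident [measurable]: "(\<lambda>x. x) \<in> lebesgue \<rightarrow>\<^sub>M (borel :: 'a::euclidean_space measure)"
  by (rule measurable_completion) simp

lemma borel_measurable_vec_nth [measurable]: "(\<lambda>x :: real ^ 'd. x $ i) \<in> borel_measurable borel"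
  by (intro borel_measurable_continuous_onI continuous_intros)

lemma inverse_fourier_integrand_integrable:
  fixes H :: "real ^ 'd \<Rightarrow> complex"
  assumes "integrable lebesgue H"
  shows "integrable lebesgue (\<lambda>\<omega>. H \<omega> * exp (\<i> * complex_of_real (\<omega> \<bullet> x)))"
  using assms by (rule Bochner_Integration.integrable_bound)
    (use borel_measurable_integrable[OF assms] in \<open>auto simp: norm_mult\<close>)

text \<open>Since \<omega> \<bullet> (T x) = (transpose T \<omega>) \<bullet> x, the phase in F (T
  x) depends on \<omega> only through \<open>transpose T *v \<omega>\<close>. Full rank makes this
  map surjective, so \<open>F_hat\<close> has an integrable image density \<open>K\<close>.\<close>

lemma trace_has_L1_fourier_transform:
  fixes T :: "real ^ 'm ^ 'n"
  assumes "rank T = CARD('m)" "has_L1_fourier_transform F F_hat"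
  shows "\<exists>f_hat. has_L1_fourier_transform (\<lambda>x. F (T *v x)) f_hat"
proof -
  have F_int: "integrable lebesgue F_hat" and F: "\<And>y. complex_of_real (F y) = inverse_fourier F_hat y"
    using assms(2) by (auto simp: has_L1_fourier_transform_def)
  have surj: "surj ((*v) (transpose T))"
    using assms(1) by (metis full_rank_surjective rank_transpose)
  obtain K where K: "integrable lebesgue K"
    and push: "\<And>\<phi>. \<phi> \<in> borel_measurable borel \<Longrightarrow> bounded (range \<phi>) \<Longrightarrow>
      (\<integral>\<omega>. F_hat \<omega> * \<phi> (transpose T *v \<omega>) \<partial>lebesgue) = (\<integral>\<xi>. K \<xi> * \<phi> \<xi> \<partial>lebesgue)"
    by (rule pushforward_density[OF matrix_vector_mul_linear surj F_int]) blast
  \<comment> \<open>The normalising constant depends on the dimension; the ratio of the two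
    constants is absorbed into the transform.\<close>
  define c :: "nat \<Rightarrow> complex" where "c = (\<lambda>d. complex_of_real ((1 / sqrt (2 * pi)) ^ d))"
  have c_nz: "c d \<noteq> 0" for d
    by (simp add: c_def)
  have "complex_of_real (F (T *v x)) =
      inverse_fourier (\<lambda>\<xi>. c (CARD('n)) / c (CARD('m)) * K \<xi>) x" for x
  proof -
    have "complex_of_real (F (T *v x)) =
        c (CARD('n)) * (\<integral>\<omega>. F_hat \<omega> * exp (\<i> * complex_of_real ((transpose T *v \<omega>) \<bullet> x)) \<partial>lebesgue)"
      by (simp add: F inverse_fourier_def c_def dot_lmul_matrix flip: vector_transpose_matrix)
    also have "\<dots> = c (CARD('n)) * (\<integral>\<xi>. K \<xi> * exp (\<i> * complex_of_real (\<xi> \<bullet> x)) \<partial>lebesgue)"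
      by (subst push) (auto simp: bounded_iff)
    also have "\<dots> = inverse_fourier (\<lambda>\<xi>. c (CARD('n)) / c (CARD('m)) * K \<xi>) x"
    proof -
      have "inverse_fourier (\<lambda>\<xi>. c (CARD('n)) / c (CARD('m)) * K \<xi>) x =
          c (CARD('m)) * (c (CARD('n)) / c (CARD('m)) * (\<integral>\<xi>. K \<xi> * exp (\<i> * complex_of_real (\<xi> \<bullet> x)) \<partial>lebesgue))"
        unfolding inverse_fourier_def by (simp only: mult.assoc integral_mult_right_zero) (simp add: c_def)
      then show ?thesis
        using c_nz by simp
    qed
    finally show ?thesis .
  qed
  moreover have "integrable lebesgue (\<lambda>\<xi>. c (CARD('n)) / c (CARD('m)) * K \<xi>)"
    using K by (rule integrable_mult_right)
  ultimately show ?thesis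
    unfolding has_L1_fourier_transform_def by blast
qed

text \<open>Averaging the phase over z with respect to \<open>P\<close> gives the characteristic
  function of \<open>P\<close> at \<open>transpose T *v \<omega>\<close>, which is the multiplier.
  The exchange of integrals is allowed because phases have modulus 1 and \<open>P\<close> has mass
  1.\<close>

lemma inverse_fourier_radial_multiplier:
  fixes T :: "real ^ 'm ^ 'n" and H :: "real ^ 'n \<Rightarrow> complex" and P :: "(real ^ 'm) measure"
  assumes "prob_space P" and sets_P[measurable_cong]: "sets P = sets borel"
    and P: "\<And>\<omega>. (\<integral>x. exp (\<i> * complex_of_real (\<omega> \<bullet> x)) \<partial>P) = complex_of_real (s (norm \<omega>))"
    and H: "integrable lebesgue H"
  shows "inverse_fourier (\<lambda>\<omega>. complex_of_real (s (norm (transpose T *v \<omega>))) * H \<omega>) y =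
    (\<integral>z. inverse_fourier H (y + T *v z) \<partial>P)"
proof -
  interpret P: prob_space P by fact
  interpret leb: sigma_finite_measure "lebesgue :: (real ^ 'n) measure"
    by (rule sigma_finite_lebesgue)
  interpret pair_sigma_finite "lebesgue :: (real ^ 'n) measure" P ..
  let ?f = "\<lambda>\<omega> z. H \<omega> * exp (\<i> * complex_of_real (\<omega> \<bullet> (y + T *v z)))"
  have [measurable]: "H \<in> borel_measurable lebesgue"
    using H by auto
  have [measurable]: "(*v) T \<in> borel_measurable borel"
    by (intro borel_measurable_linear matrix_vector_mul_linear)
  have [measurable]: "case_prod ?f \<in> borel_measurable (lebesgue \<Otimes>\<^sub>M P)"
    by measurable
  have "integrable (lebesgue \<Otimes>\<^sub>M P) (case_prod ?f)"
  proof (rule Fubini_integrable)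
    show "AE \<omega> in lebesgue. integrable P (\<lambda>z. case_prod ?f (\<omega>, z))"
      by (intro AE_I2 P.integrable_const_bound[where B = "norm (H _)"]) (auto simp: norm_mult)
  qed (use H P.prob_space in \<open>auto simp: norm_mult\<close>)
  note swap = Fubini_integral[OF this]
  have inner: "(\<integral>z. ?f \<omega> z \<partial>P) =
      complex_of_real (s (norm (transpose T *v \<omega>))) * H \<omega> * exp (\<i> * complex_of_real (\<omega> \<bullet> y))" for \<omega>
  proof -
    have "\<omega> \<bullet> (T *v z) = (transpose T *v \<omega>) \<bullet> z" for z
      by (simp add: dot_lmul_matrix flip: vector_transpose_matrix)
    then have "(\<integral>z. ?f \<omega> z \<partial>P) = (\<integral>z. H \<omega> * exp (\<i> * complex_of_real (\<omega> \<bullet> y)) *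
        exp (\<i> * complex_of_real ((transpose T *v \<omega>) \<bullet> z)) \<partial>P)"
      by (simp add: inner_add_right distrib_left exp_add mult.assoc)
    also have "\<dots> = H \<omega> * exp (\<i> * complex_of_real (\<omega> \<bullet> y)) * complex_of_real (s (norm (transpose T *v \<omega>)))"
      by (simp only: integral_mult_right_zero P)
    finally show ?thesis
      by (simp only: mult_ac)
  qed
  show ?thesis
    unfolding inverse_fourier_def by (subst integral_mult_right_zero) (simp only: swap inner)
qed

text \<open>One statement serves both resolvents: \<open>T\<close> itself yields \<open>U\<close>,
  and the identity matrix yields \<open>u\<close>. The right-hand side is visibly real.\<close>

lemma inverse_fourier_resolvent:
  fixes T :: "real ^ 'm ^ 'n" and P :: "(real ^ 'm) measure"
  assumes "\<mu> > 0" "prob_space P" "sets P = sets borel"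
    and P: "\<And>\<omega>. (\<integral>x. exp (\<i> * complex_of_real (\<omega> \<bullet> x)) \<partial>P) = complex_of_real (\<mu> / (\<mu> + (norm \<omega>)\<^sup>2))"
    and g_hat: "has_L1_fourier_transform g g_hat"
  shows "inverse_fourier (\<lambda>\<omega>. complex_of_real (1 / (\<mu> + (norm (transpose T *v \<omega>))\<^sup>2)) * g_hat \<omega>) y =
    complex_of_real ((\<integral>z. g (y + T *v z) \<partial>P) / \<mu>)"
proof -
  \<comment> \<open>The characteristic function of \<open>P\<close> is \<mu> times the resolvent
    symbol, and \<open>H\<close> compensates for this factor.\<close>
  define H where "H = (\<lambda>\<omega>. complex_of_real (1 / \<mu>) * g_hat \<omega>)"
  have H_int: "integrable lebesgue H"
    using g_hat unfolding H_def has_L1_fourier_transform_def by (intro integrable_mult_right) simp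
  have H_inv: "inverse_fourier H x = complex_of_real (g x / \<mu>)" for x
  proof -
    have "inverse_fourier H x = complex_of_real (1 / \<mu>) * inverse_fourier g_hat x"
      by (simp add: H_def inverse_fourier_def mult.assoc)
    then show ?thesis
      using g_hat by (simp add: has_L1_fourier_transform_def flip: of_real_mult)
  qed
  have "complex_of_real (1 / (\<mu> + r\<^sup>2)) * g_hat \<omega> = complex_of_real (\<mu> / (\<mu> + r\<^sup>2)) * H \<omega>" for r \<omega>
    using assms(1) by (simp add: H_def)
  then have "inverse_fourier (\<lambda>\<omega>. complex_of_real (1 / (\<mu> + (norm (transpose T *v \<omega>))\<^sup>2)) * g_hat \<omega>) y =
      inverse_fourier (\<lambda>\<omega>. complex_of_real (\<mu> / (\<mu> + (norm (transpose T *v \<omega>))\<^sup>2)) * H \<omega>) y"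
    by (simp only:)
  also have "\<dots> = (\<integral>z. inverse_fourier H (y + T *v z) \<partial>P)"
    using assms(2,3) P H_int by (rule inverse_fourier_radial_multiplier)
  also have "\<dots> = complex_of_real ((\<integral>z. g (y + T *v z) \<partial>P) / \<mu>)"
    by (simp only: H_inv integral_complex_of_real integral_divide_zero)
  finally show ?thesis .
qed

section \<open>Differentiation of Fourier integrals\<close>

lemma continuous_inverse_fourier:
  fixes H :: "real ^ 'd \<Rightarrow> complex"
  assumes H: "integrable lebesgue H"
  shows "continuous_on UNIV (inverse_fourier H)"
proof -
  have [measurable]: "H \<in> borel_measurable lebesgue"
    using H by auto
  have "(\<lambda>k. \<integral>\<omega>. H \<omega> * exp (\<i> * complex_of_real (\<omega> \<bullet> X k)) \<partial>lebesgue) \<longlonglongrightarrow>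
      (\<integral>\<omega>. H \<omega> * exp (\<i> * complex_of_real (\<omega> \<bullet> x)) \<partial>lebesgue)"
    if "X \<longlonglongrightarrow> x" for X :: "nat \<Rightarrow> real ^ 'd" and x
  proof (rule integral_dominated_convergence[where w = "\<lambda>\<omega>. norm (H \<omega>)"])
    show "AE \<omega> in lebesgue. (\<lambda>k. H \<omega> * exp (\<i> * complex_of_real (\<omega> \<bullet> X k))) \<longlonglongrightarrow>
        H \<omega> * exp (\<i> * complex_of_real (\<omega> \<bullet> x))"
      using that by (intro AE_I2 tendsto_intros)
  qed (use H in \<open>auto simp: norm_mult\<close>)
  then show ?thesis
    unfolding continuous_on_sequentially inverse_fourier_def comp_def
    by (auto intro!: tendsto_mult_left)
qed

text \<open>The quadratic bound yields the pointwise limit of difference quotients, the linear one a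
  majorant that uses only the first moment.\<close>

lemma norm_iexp_minus_linear_le:
  "norm (exp (\<i> * complex_of_real t) - 1 - \<i> * complex_of_real t) \<le> t\<^sup>2 / 2"
  "norm (exp (\<i> * complex_of_real t) - 1 - \<i> * complex_of_real t) \<le> 2 * \<bar>t\<bar>"
  using iexp_approx1[of t 1] iexp_approx2[of t 1]
  by (simp_all add: algebra_simps power2_eq_square)

text \<open>Differentiation under the integral: the remainder quotient tends to 0 pointwise and is
  dominated by 2 |\<omega>| |H \<omega>|, which is integrable by \<open>H1\<close>.\<close>

lemma has_derivative_inverse_fourier:
  fixes H :: "real ^ 'd \<Rightarrow> complex"
  assumes H: "integrable lebesgue H"
    and H1: "integrable lebesgue (\<lambda>\<omega>. complex_of_real (norm \<omega>) * H \<omega>)"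
  shows "(inverse_fourier H has_derivative
    (\<lambda>v. inverse_fourier (\<lambda>\<omega>. \<i> * complex_of_real (\<omega> \<bullet> v) * H \<omega>) x)) (at x)"
proof -
  have [measurable]: "H \<in> borel_measurable lebesgue"
    using H by auto
  define e where "e = (\<lambda>\<omega>. exp (\<i> * complex_of_real (\<omega> \<bullet> x)))"
  have [measurable]: "e \<in> borel_measurable lebesgue"
    unfolding e_def by measurable
  have e_norm[simp]: "norm (e \<omega>) = 1" for \<omega>
    by (simp add: e_def)
  define I where "I = (\<lambda>y. \<integral>\<omega>. H \<omega> * exp (\<i> * complex_of_real (\<omega> \<bullet> y)) \<partial>lebesgue)"
  define D where "D = (\<lambda>v. \<integral>\<omega>. \<i> * complex_of_real (\<omega> \<bullet> v) * H \<omega> * e \<omega> \<partial>lebesgue)"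
  have D_int: "integrable lebesgue (\<lambda>\<omega>. \<i> * complex_of_real (\<omega> \<bullet> v) * H \<omega> * e \<omega>)" for v
  proof (rule Bochner_Integration.integrable_bound)
    show "integrable lebesgue (\<lambda>\<omega>. norm v * (complex_of_real (norm \<omega>) * H \<omega>))"
      using H1 by (intro integrable_mult_right)
    show "AE \<omega> in lebesgue. norm (\<i> * complex_of_real (\<omega> \<bullet> v) * H \<omega> * e \<omega>) \<le>
        norm (norm v * (complex_of_real (norm \<omega>) * H \<omega>))"
    proof (rule AE_I2)
      fix \<omega>
      have "\<bar>\<omega> \<bullet> v\<bar> * norm (H \<omega>) \<le> norm \<omega> * norm v * norm (H \<omega>)"
        by (intro mult_right_mono Cauchy_Schwarz_ineq2) auto
      then show "norm (\<i> * complex_of_real (\<omega> \<bullet> v) * H \<omega> * e \<omega>) \<le>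
          norm (norm v * (complex_of_real (norm \<omega>) * H \<omega>))"
        by (simp add: norm_mult mult_ac)
    qed
  qed measurable
  have I_int: "integrable lebesgue (\<lambda>\<omega>. H \<omega> * exp (\<i> * complex_of_real (\<omega> \<bullet> y)))" for y
    using H by (rule inverse_fourier_integrand_integrable)
  have "linear D"
  proof (rule linearI)
    show "D (v + w) = D v + D w" for v w
      unfolding D_def
      by (subst Bochner_Integration.integral_add[symmetric, OF D_int D_int])
         (simp add: algebra_simps)
    show "D (r *\<^sub>R v) = r *\<^sub>R D v" for r v
      unfolding D_def integral_scaleR_right[symmetric]
      by (simp add: scaleR_conv_of_real[where 'a = complex] mult_ac)
  qed
  have "(I has_derivative D) (at x)"
    unfolding has_derivative_at_within
  proof
    show "bounded_linear D"
      using \<open>linear D\<close> by (simp add: linear_linear)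
    show "(\<lambda>y. (I y - I x - D (y - x)) /\<^sub>R norm (y - x)) \<midarrow>x\<rightarrow> 0"
      \<comment> \<open>The limit is tested along sequences, to which dominated convergence
        applies.\<close>
      unfolding tendsto_at_iff_sequentially comp_def
    proof (intro allI impI)
      fix X :: "nat \<Rightarrow> real ^ 'd"
      assume "\<forall>i. X i \<in> UNIV - {x}" and X: "X \<longlonglongrightarrow> x"
      then have Xnz: "norm (X k - x) > 0" for k
        by auto
      \<comment> \<open>\<open>R k\<close> is the integrand of the remainder quotient, with the
        unimodular phase at \<open>x\<close> factored out.\<close>
      define R where "R = (\<lambda>k \<omega>. H \<omega> * e \<omega> *
        (exp (\<i> * complex_of_real (\<omega> \<bullet> (X k - x))) - 1 - \<i> * complex_of_real (\<omega> \<bullet> (X k - x))) /\<^sub>R norm (X k - x))"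
      have R_bound: "norm (R k \<omega>) \<le> norm (H \<omega>) * (b / norm (X k - x))"
        if "norm (exp (\<i> * complex_of_real (\<omega> \<bullet> (X k - x))) - 1 - \<i> * complex_of_real (\<omega> \<bullet> (X k - x))) \<le> b" for k \<omega> b
      proof -
        have "norm (R k \<omega>) = norm (H \<omega>) * (norm (exp (\<i> * complex_of_real (\<omega> \<bullet> (X k - x))) - 1 -
            \<i> * complex_of_real (\<omega> \<bullet> (X k - x))) / norm (X k - x))"
          by (simp add: R_def norm_mult divide_inverse mult_ac)
        then show ?thesis
          using that by (simp only:) (intro mult_left_mono divide_right_mono, auto)
      qed
      \<comment> \<open>This bound tends to 0 for each fixed \<omega>, but its second moment need
        not be integrable.\<close>
      have R_le1: "norm (R k \<omega>) \<le> norm (H \<omega>) * ((norm \<omega>)\<^sup>2 / 2) * norm (X k - x)" for k \<omega>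
      proof -
        have "(\<omega> \<bullet> (X k - x))\<^sup>2 \<le> (norm \<omega>)\<^sup>2 * (norm (X k - x))\<^sup>2"
          using Cauchy_Schwarz_ineq2[of \<omega> "X k - x"] power_mono[of "\<bar>\<omega> \<bullet> (X k - x)\<bar>" _ 2]
          by (fastforce simp: power_mult_distrib)
        then have "norm (R k \<omega>) \<le> norm (H \<omega>) * ((norm \<omega>)\<^sup>2 * (norm (X k - x))\<^sup>2 / 2 / norm (X k - x))"
          by (intro R_bound order_trans[OF norm_iexp_minus_linear_le(1)]) simp
        then show ?thesis
          using Xnz[of k] by (simp add: power2_eq_square)
      qed
      \<comment> \<open>The increment cancels here, leaving a majorant independent of k.\<close>
      have R_le2: "norm (R k \<omega>) \<le> 2 * norm (complex_of_real (norm \<omega>) * H \<omega>)" for k \<omega>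
      proof -
        have "norm (R k \<omega>) \<le> norm (H \<omega>) * (2 * (norm \<omega> * norm (X k - x)) / norm (X k - x))"
          using Cauchy_Schwarz_ineq2[of \<omega> "X k - x"]
          by (intro R_bound order_trans[OF norm_iexp_minus_linear_le(2)]) simp
        then show ?thesis
          using Xnz[of k] by (simp add: norm_mult mult_ac)
      qed
      have "(I (X k) - I x - D (X k - x)) /\<^sub>R norm (X k - x) = (\<integral>\<omega>. R k \<omega> \<partial>lebesgue)" for k
      proof -
        have split: "exp (\<i> * complex_of_real (\<omega> \<bullet> X k)) = e \<omega> * exp (\<i> * complex_of_real (\<omega> \<bullet> (X k - x)))" for \<omega>
          by (simp add: e_def inner_diff_right flip: exp_add distrib_left of_real_add)
        have e_fold: "exp (\<i> * complex_of_real (\<omega> \<bullet> x)) = e \<omega>" for \<omega>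
          by (simp add: e_def)
        have rescale: "a * (b * E) - a * b - \<i> * t * a * b = r *\<^sub>R (a * b * (E - 1 - \<i> * t) /\<^sub>R r)"
          if "r > 0" for a b E t :: complex and r :: real
          using that by (simp add: algebra_simps)
        have "I (X k) - I x - D (X k - x) =
          (\<integral>\<omega>. H \<omega> * exp (\<i> * complex_of_real (\<omega> \<bullet> X k)) - H \<omega> * exp (\<i> * complex_of_real (\<omega> \<bullet> x)) -
            \<i> * complex_of_real (\<omega> \<bullet> (X k - x)) * H \<omega> * e \<omega> \<partial>lebesgue)"
          unfolding I_def D_def
          by (subst Bochner_Integration.integral_diff, intro Bochner_Integration.integrable_diff I_int, rule D_int,
              subst Bochner_Integration.integral_diff, (rule I_int)+, rule refl)
        also have "\<dots> = (\<integral>\<omega>. norm (X k - x) *\<^sub>R R k \<omega> \<partial>lebesgue)"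
          unfolding R_def split e_fold by (intro Bochner_Integration.integral_cong refl rescale Xnz)
        also have "\<dots> = norm (X k - x) *\<^sub>R (\<integral>\<omega>. R k \<omega> \<partial>lebesgue)"
          by (rule integral_scaleR_right)
        finally show ?thesis
          using Xnz[of k] by simp
      qed
      moreover have "(\<lambda>k. \<integral>\<omega>. R k \<omega> \<partial>lebesgue) \<longlonglongrightarrow> (\<integral>\<omega>. 0 \<partial>(lebesgue :: (real ^ 'd) measure))"
      proof (rule integral_dominated_convergence[where w = "\<lambda>\<omega>. 2 * norm (complex_of_real (norm \<omega>) * H \<omega>)"])
        show "R k \<in> borel_measurable lebesgue" for k
          unfolding R_def by measurable
        show "AE \<omega> in lebesgue. (\<lambda>k. R k \<omega>) \<longlonglongrightarrow> 0"
        proof (rule AE_I2)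
          fix \<omega>
          have "(\<lambda>k. norm (H \<omega>) * ((norm \<omega>)\<^sup>2 / 2) * norm (X k - x)) \<longlonglongrightarrow> norm (H \<omega>) * ((norm \<omega>)\<^sup>2 / 2) * norm (x - x)"
            using X by (intro tendsto_intros)
          then have "(\<lambda>k. norm (H \<omega>) * ((norm \<omega>)\<^sup>2 / 2) * norm (X k - x)) \<longlonglongrightarrow> 0"
            by simp
          then show "(\<lambda>k. R k \<omega>) \<longlonglongrightarrow> 0"
            by (rule Lim_null_comparison[rotated]) (intro always_eventually allI R_le1)
        qed
        show "AE \<omega> in lebesgue. norm (R k \<omega>) \<le> 2 * norm (complex_of_real (norm \<omega>) * H \<omega>)" for k
          using R_le2 by simp
      qed (use H1 in auto)
      ultimately show "(\<lambda>k. (I (X k) - I x - D (X k - x)) /\<^sub>R norm (X k - x)) \<longlonglongrightarrow> 0"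
        by simp
    qed
  qed
  then have "((\<lambda>y. complex_of_real ((1 / sqrt (2 * pi)) ^ CARD('d)) * I y) has_derivative
      (\<lambda>v. complex_of_real ((1 / sqrt (2 * pi)) ^ CARD('d)) * D v)) (at x)"
    by (rule has_derivative_mult_right)
  then show ?thesis
    unfolding inverse_fourier_def I_def D_def e_def .
qed

text \<open>The formula for the partial derivative has the shape of the assumption on
  \<open>g\<close>, so the lemma can be iterated. Continuity follows because |\<omega>_i| \<le>
  |\<omega>| keeps the new symbol integrable.\<close>

lemma partial_deriv_inverse_fourier:
  fixes g :: "real ^ 'd \<Rightarrow> real"
  assumes H: "integrable lebesgue H"
    and H1: "integrable lebesgue (\<lambda>\<omega>. complex_of_real (norm \<omega>) * H \<omega>)"
    and g: "\<And>x. g x = Re (inverse_fourier H x)"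
  shows "C1_on_space g"
    and "partial_deriv i g x = Re (inverse_fourier (\<lambda>\<omega>. \<i> * complex_of_real (\<omega> $ i) * H \<omega>) x)"
proof -
  have "g = (\<lambda>x. Re (inverse_fourier H x))"
    using g by auto
  then have deriv: "(g has_derivative (\<lambda>v. Re (inverse_fourier (\<lambda>\<omega>. \<i> * complex_of_real (\<omega> \<bullet> v) * H \<omega>) x))) (at x)" for x
    using has_derivative_Re[OF has_derivative_inverse_fourier[OF H H1]] by simp
  have pd: "partial_deriv i g x = Re (inverse_fourier (\<lambda>\<omega>. \<i> * complex_of_real (\<omega> $ i) * H \<omega>) x)" for i x
    unfolding partial_deriv_def frechet_derivative_at[OF deriv, symmetric] by (simp add: inner_axis)
  then show "partial_deriv i g x = Re (inverse_fourier (\<lambda>\<omega>. \<i> * complex_of_real (\<omega> $ i) * H \<omega>) x)" .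
  have [measurable]: "H \<in> borel_measurable lebesgue"
    using H by auto
  have "integrable lebesgue (\<lambda>\<omega>. \<i> * complex_of_real (\<omega> $ i) * H \<omega>)" for i
    using H1
  proof (rule Bochner_Integration.integrable_bound)
    show "(\<lambda>\<omega>. \<i> * complex_of_real (\<omega> $ i) * H \<omega>) \<in> borel_measurable lebesgue"
      by measurable
  qed (auto simp: norm_mult intro!: mult_right_mono component_le_norm_cart)
  then show "C1_on_space g"
    unfolding C1_on_space_def pd
    using deriv by (auto simp: differentiable_def intro!: continuous_on_Re continuous_inverse_fourier)
qed

lemma inverse_fourier_diff:
  fixes G H :: "real ^ 'd \<Rightarrow> complex"
  assumes "integrable lebesgue G" "integrable lebesgue H"
  shows "inverse_fourier (\<lambda>\<omega>. G \<omega> - H \<omega>) x = inverse_fourier G x - inverse_fourier H x"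
  using assms
  by (simp add: inverse_fourier_def left_diff_distrib right_diff_distrib inverse_fourier_integrand_integrable)

lemma inverse_fourier_sum:
  fixes H :: "'i \<Rightarrow> real ^ 'd \<Rightarrow> complex"
  assumes "\<And>i. i \<in> I \<Longrightarrow> integrable lebesgue (H i)"
  shows "inverse_fourier (\<lambda>\<omega>. \<Sum>i\<in>I. H i \<omega>) x = (\<Sum>i\<in>I. inverse_fourier (H i) x)"
  using assms
  by (simp add: inverse_fourier_def sum_distrib_right sum_distrib_left inverse_fourier_integrand_integrable)

section \<open>The screened Poisson equation\<close>

text \<open>The resolvent gains two powers of \<omega>, which pays for two derivatives. The operator
  then has symbol \<mu> + |\<omega>|^2 and cancels the resolvent.\<close>

lemma solves_screened_poisson_inverse_fourier:
  fixes u :: "real ^ 'd \<Rightarrow> real"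
  assumes "\<mu> > 0" and f_hat: "has_L1_fourier_transform f f_hat"
    and u: "\<And>x. complex_of_real (u x) =
      inverse_fourier (\<lambda>\<omega>. complex_of_real (1 / (\<mu> + (norm \<omega>)\<^sup>2)) * f_hat \<omega>) x"
  shows "solves_screened_poisson \<mu> f u"
proof -
  have int: "integrable lebesgue f_hat" and f: "\<And>x. complex_of_real (f x) = inverse_fourier f_hat x"
    using f_hat by (auto simp: has_L1_fourier_transform_def)
  then have [measurable]: "f_hat \<in> borel_measurable lebesgue"
    by auto
  define H where "H = (\<lambda>\<omega>. complex_of_real (1 / (\<mu> + (norm \<omega>)\<^sup>2)) * f_hat \<omega>)"
  have pos: "\<mu> + (norm \<omega>)\<^sup>2 > 0" for \<omega> :: "real ^ 'd"
    using assms(1) by (simp add: add_pos_nonneg)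
  \<comment> \<open>One criterion covers all symbols up to order two; the constant comes from 1 +
    r^2 \<le> (1 / \<mu> + 1) (\<mu> + r^2).\<close>
  have mult_int: "integrable lebesgue (\<lambda>\<omega>. p \<omega> * H \<omega>)"
    if [measurable]: "p \<in> borel_measurable lebesgue" and p: "\<And>\<omega>. norm (p \<omega>) \<le> 1 + (norm \<omega>)\<^sup>2" for p
  proof (rule Bochner_Integration.integrable_bound)
    show "integrable lebesgue (\<lambda>\<omega>. complex_of_real (1 / \<mu> + 1) * f_hat \<omega>)"
      using int by (rule integrable_mult_right)
    show "(\<lambda>\<omega>. p \<omega> * H \<omega>) \<in> borel_measurable lebesgue"
      unfolding H_def by measurable
    show "AE \<omega> in lebesgue. norm (p \<omega> * H \<omega>) \<le> norm (complex_of_real (1 / \<mu> + 1) * f_hat \<omega>)"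
    proof (rule AE_I2)
      fix \<omega>
      have "norm (p \<omega>) \<le> (1 / \<mu> + 1) * (\<mu> + (norm \<omega>)\<^sup>2)"
        using assms(1) by (intro order_trans[OF p]) (simp add: field_simps)
      then have "norm (p \<omega>) * (1 / (\<mu> + (norm \<omega>)\<^sup>2)) \<le> 1 / \<mu> + 1"
        using pos[of \<omega>] by (simp add: pos_divide_le_eq)
      then have "norm (p \<omega>) * (1 / (\<mu> + (norm \<omega>)\<^sup>2)) * norm (f_hat \<omega>) \<le> (1 / \<mu> + 1) * norm (f_hat \<omega>)"
        by (rule mult_right_mono) simp
      moreover have "norm (p \<omega> * H \<omega>) = norm (p \<omega>) * (1 / (\<mu> + (norm \<omega>)\<^sup>2)) * norm (f_hat \<omega>)"
        using pos[of \<omega>] by (simp only: H_def norm_mult norm_of_real) simp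
      moreover have "norm (complex_of_real (1 / \<mu> + 1) * f_hat \<omega>) = (1 / \<mu> + 1) * norm (f_hat \<omega>)"
        using assms(1) by (simp only: norm_mult norm_of_real) simp
      ultimately show "norm (p \<omega> * H \<omega>) \<le> norm (complex_of_real (1 / \<mu> + 1) * f_hat \<omega>)"
        by simp
    qed
  qed
  have norm_le: "norm \<omega> \<le> 1 + (norm \<omega>)\<^sup>2" for \<omega> :: "real ^ 'd"
    using sum_squares_bound[of 1 "norm \<omega>"] norm_ge_zero[of \<omega>] unfolding power2_eq_square by linarith
  have H_int: "integrable lebesgue H"
    using mult_int[of "\<lambda>_. 1"] by simp
  have H1_int: "integrable lebesgue (\<lambda>\<omega>. complex_of_real (norm \<omega>) * H \<omega>)"
    using norm_le by (intro mult_int) auto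
  have Hi_int: "integrable lebesgue (\<lambda>\<omega>. \<i> * complex_of_real (\<omega> $ i) * H \<omega>)" for i
    using norm_le by (intro mult_int) (auto simp: norm_mult intro: order_trans[OF component_le_norm_cart])
  have Hi1_int: "integrable lebesgue (\<lambda>\<omega>. complex_of_real (norm \<omega>) * (\<i> * complex_of_real (\<omega> $ i) * H \<omega>))" for i
    unfolding mult.assoc[symmetric]
  proof (intro mult_int)
    fix \<omega> :: "real ^ 'd"
    have "norm \<omega> * \<bar>\<omega> $ i\<bar> \<le> norm \<omega> * norm \<omega>"
      by (intro mult_left_mono component_le_norm_cart) auto
    then show "norm (complex_of_real (norm \<omega>) * \<i> * complex_of_real (\<omega> $ i)) \<le> 1 + (norm \<omega>)\<^sup>2"
      by (simp add: norm_mult power2_eq_square)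
  qed measurable
  have Hii_int: "integrable lebesgue (\<lambda>\<omega>. \<i> * complex_of_real (\<omega> $ i) * (\<i> * complex_of_real (\<omega> $ i) * H \<omega>))" for i
    unfolding mult.assoc[symmetric]
  proof (intro mult_int)
    fix \<omega> :: "real ^ 'd"
    have "\<bar>\<omega> $ i\<bar> * \<bar>\<omega> $ i\<bar> \<le> norm \<omega> * norm \<omega>"
      by (intro mult_mono component_le_norm_cart) auto
    then show "norm (\<i> * complex_of_real (\<omega> $ i) * \<i> * complex_of_real (\<omega> $ i)) \<le> 1 + (norm \<omega>)\<^sup>2"
      by (simp add: norm_mult power2_eq_square)
  qed measurable
  have u_Re: "u x = Re (inverse_fourier H x)" for x
    using arg_cong[OF u[of x], of Re] by (simp add: H_def)
  note D1 = partial_deriv_inverse_fourier[OF H_int H1_int u_Re]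
  \<comment> \<open>The lemma is applied again, now to the first partial derivatives of
    \<open>u\<close>.\<close>
  note D2 = partial_deriv_inverse_fourier[OF Hi_int Hi1_int D1(2)]
  have "- laplacian u x + \<mu> * u x = f x" for x
  proof -
    \<comment> \<open>Each second derivative has symbol -(\<omega>_i)^2, so subtracting their sum
      adds |\<omega>|^2 to \<mu>.\<close>
    have H_split: "f_hat \<omega> = complex_of_real \<mu> * H \<omega> -
        (\<Sum>i\<in>UNIV. \<i> * complex_of_real (\<omega> $ i) * (\<i> * complex_of_real (\<omega> $ i) * H \<omega>))" for \<omega>
    proof -
      have "(\<Sum>i\<in>UNIV. \<i> * complex_of_real (\<omega> $ i) * (\<i> * complex_of_real (\<omega> $ i) * H \<omega>)) =
          - (complex_of_real (\<Sum>i\<in>UNIV. (\<omega> $ i)\<^sup>2) * H \<omega>)"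
        by (simp add: sum_negf sum_distrib_left sum_distrib_right power2_eq_square mult_ac)
      also have "(\<Sum>i\<in>UNIV. (\<omega> $ i)\<^sup>2) = (norm \<omega>)\<^sup>2"
        by (simp add: norm_vec_def L2_set_def sum_nonneg)
      also have "complex_of_real \<mu> * H \<omega> - - (complex_of_real ((norm \<omega>)\<^sup>2) * H \<omega>) =
          complex_of_real (\<mu> + (norm \<omega>)\<^sup>2) * H \<omega>"
        by (simp add: distrib_right)
      also have "\<dots> = f_hat \<omega>"
        using pos[of \<omega>] by (simp add: H_def del: of_real_add)
      finally show ?thesis ..
    qed
    have "complex_of_real (f x) = inverse_fourier (\<lambda>\<omega>. complex_of_real \<mu> * H \<omega> -
        (\<Sum>i\<in>UNIV. \<i> * complex_of_real (\<omega> $ i) * (\<i> * complex_of_real (\<omega> $ i) * H \<omega>))) x"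
      by (simp only: f H_split[symmetric])
    also have "\<dots> = inverse_fourier (\<lambda>\<omega>. complex_of_real \<mu> * H \<omega>) x -
        (\<Sum>i\<in>UNIV. inverse_fourier (\<lambda>\<omega>. \<i> * complex_of_real (\<omega> $ i) * (\<i> * complex_of_real (\<omega> $ i) * H \<omega>)) x)"
      by (subst inverse_fourier_diff)
         (intro integrable_mult_right H_int Bochner_Integration.integrable_sum Hii_int
            inverse_fourier_sum arg_cong2[where f = minus] refl)+
    also have "inverse_fourier (\<lambda>\<omega>. complex_of_real \<mu> * H \<omega>) x = complex_of_real \<mu> * inverse_fourier H x"
      by (simp add: inverse_fourier_def mult.assoc)
    finally have "Re (complex_of_real (f x)) = Re (complex_of_real \<mu> * inverse_fourier H x -
        (\<Sum>i\<in>UNIV. inverse_fourier (\<lambda>\<omega>. \<i> * complex_of_real (\<omega> $ i) * (\<i> * complex_of_real (\<omega> $ i) * H \<omega>)) x))"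
      by (rule arg_cong)
    then have "f x = \<mu> * u x - (\<Sum>i\<in>UNIV. partial_deriv i (partial_deriv i u) x)"
      unfolding D2(2) u_Re by simp
    then show ?thesis
      by (simp add: laplacian_def)
  qed
  then show ?thesis
    using D1(1) D2(1) by (simp add: solves_screened_poisson_def C2_on_space_def)
qed

section \<open>Both resolvents as averages, and the trace identity\<close>

theorem theorem3p2:
  fixes T :: "real ^ 'm ^ 'n" and \<mu> :: real
    and F :: "real ^ 'n \<Rightarrow> real" and F_hat :: "real ^ 'n \<Rightarrow> complex"
    and f :: "real ^ 'm \<Rightarrow> real"
  assumes "CARD('m) < CARD('n)"
    and "rank T = CARD('m)"
    and "\<mu> > 0"
    and "has_L1_fourier_transform F F_hat"
    and "\<And>x. f x = F (T *v x)"
  shows "(\<exists>f_hat. has_L1_fourier_transform f f_hat) \<and>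
    (\<forall>f_hat. has_L1_fourier_transform f f_hat \<longrightarrow>
      (\<exists>(u :: real ^ 'm \<Rightarrow> real) (U :: real ^ 'n \<Rightarrow> real).
        (\<forall>x. complex_of_real (u x) =
           inverse_fourier (\<lambda>\<omega>. complex_of_real (1 / (\<mu> + (norm \<omega>)\<^sup>2)) * f_hat \<omega>) x) \<and>
        solves_screened_poisson \<mu> f u \<and>
        (\<forall>y. complex_of_real (U y) =
           inverse_fourier (\<lambda>\<omega>. complex_of_real (1 / (\<mu> + (norm (transpose T *v \<omega>))\<^sup>2)) * F_hat \<omega>) y) \<and>
        (\<forall>x. u x = U (T *v x))))"
proof (intro conjI allI impI)
  have f_eq: "f = (\<lambda>x. F (T *v x))"
    using assms(5) by auto
  show "\<exists>f_hat. has_L1_fourier_transform f f_hat"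
    unfolding f_eq using assms(2,4) by (rule trace_has_L1_fourier_transform)
  fix f_hat
  assume f_hat: "has_L1_fourier_transform f f_hat"
  obtain P :: "(real ^ 'm) measure" where P: "prob_space P" "sets P = sets borel"
    "\<And>\<omega>. (\<integral>x. exp (\<i> * complex_of_real (\<omega> \<bullet> x)) \<partial>P) = complex_of_real (\<mu> / (\<mu> + (norm \<omega>)\<^sup>2))"
    using resolvent_measure_exists[OF assms(3)] by blast
  \<comment> \<open>Defining \<open>u\<close> and \<open>U\<close> as averages makes them
    real-valued from the start; the Fourier formulas are then proved for the given
    \<open>f_hat\<close>, whichever transform of \<open>f\<close> it is.\<close>
  define u where "u = (\<lambda>x. (\<integral>z. f (x + z) \<partial>P) / \<mu>)"
  define U where "U = (\<lambda>y. (\<integral>z. F (y + T *v z) \<partial>P) / \<mu>)"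
  have u: "complex_of_real (u x) = inverse_fourier (\<lambda>\<omega>. complex_of_real (1 / (\<mu> + (norm \<omega>)\<^sup>2)) * f_hat \<omega>) x" for x
    using inverse_fourier_resolvent[OF assms(3) P f_hat, of "mat 1" x]
    by (simp add: u_def)
  have U: "complex_of_real (U y) =
      inverse_fourier (\<lambda>\<omega>. complex_of_real (1 / (\<mu> + (norm (transpose T *v \<omega>))\<^sup>2)) * F_hat \<omega>) y" for y
    unfolding U_def by (rule inverse_fourier_resolvent[OF assms(3) P assms(4), symmetric])
  \<comment> \<open>By linearity F (T x + T z) = F (T (x + z)) = f (x + z), so the two averages
    agree integrand by integrand.\<close>
  have "u x = U (T *v x)" for x
    by (simp add: u_def U_def f_eq matrix_vector_right_distrib)
  then show "\<exists>(u :: real ^ 'm \<Rightarrow> real) (U :: real ^ 'n \<Rightarrow> real).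
        (\<forall>x. complex_of_real (u x) =
           inverse_fourier (\<lambda>\<omega>. complex_of_real (1 / (\<mu> + (norm \<omega>)\<^sup>2)) * f_hat \<omega>) x) \<and>
        solves_screened_poisson \<mu> f u \<and>
        (\<forall>y. complex_of_real (U y) =
           inverse_fourier (\<lambda>\<omega>. complex_of_real (1 / (\<mu> + (norm (transpose T *v \<omega>))\<^sup>2)) * F_hat \<omega>) y) \<and>
        (\<forall>x. u x = U (T *v x))"
    using u U solves_screened_poisson_inverse_fourier[OF assms(3) f_hat u] by blast
qed

end
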